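(* Let $\Omega$ be a nonempty closed subset of $\mathbb{R}^n$, let $I=\{1,\ldots,m\}$, $J=\{1,\ldots,p\}$, and let $f_i:\mathbb{R}^n\to\mathbb{R}$ ($i\in I$) and $g_j:\mathbb{R}^n\to\mathbb{R}$ ($j\in J$) be lower semicontinuous functions that are Lipschitz at infinity. Let $\mathcal{F}=\{x\in\Omega: g_j(x)\le 0,\ j\in J\}$ and $\varphi=\max_{i\in I}f_i$. Assume that $\mathcal{F}$ is nonempty and unbounded and that $\varphi$ is bounded from below on $\mathcal{F}$. If the constraint qualification (CQ) holds at infinity, i.e. there do not exist $\beta_j\ge 0$, $j\in J$, such that $\sum_{j\in J}\beta_j>0$ and $0\in\sum_{j\in J}\beta_j\partial g_j(\infty)+N_\Omega(\infty)$, and if $$0\notin\mathrm{co}\,\{\partial f_1(\infty),\ldots,\partial f_m(\infty)\}+\mathrm{pos}\,\{\partial g_1(\infty),\ldots,\partial g_p(\infty)\}+N_\Omega(\infty),$$ then the global solution set $\{\bar x\in\mathcal{F}:\varphi(\bar x)=\inf_{x\in\mathcal{F}}\varphi(x)\}$ of the problem $\min_{x\in\mathcal{F}}\max_{i\in I}f_i(x)$ is nonempty and compact.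
   Context: $\mathbb{R}^n$ carries the Euclidean inner product and norm; $\mathbb{B}_R$ is the closed ball of radius $R$ centered at the origin; $\mathrm{epi}\, f=\{(x,\alpha)\in\mathbb{R}^n\times\mathbb{R}:\alpha\ge f(x)\}$. Sums and scalar multiples of sets are in the Minkowski sense. $\mathrm{co}\,\{D_1,\ldots,D_m\}$ denotes the convex hull of $D_1\cup\cdots\cup D_m$, and $\mathrm{pos}\,\{D_1,\ldots,D_p\}=\{\sum_{j=1}^p\beta_jv_j:\beta_j\ge 0,\ v_j\in D_j,\ j=1,\ldots,p\}$. A lower semicontinuous function $f:\mathbb{R}^n\to\mathbb{R}$ is Lipschitz at infinity if there exist $L>0$, $R>0$ with $|f(x)-f(x')|\le L\|x-x'\|$ for all $x,x'\in\mathbb{R}^n\setminus\mathbb{B}_R$. For a set $D\subset\mathbb{R}^d$ and $\bar x\in D$, the Fréchet normal cone is $\widehat N_D(\bar x)=\{v\in\mathbb{R}^d:\limsup_{x\to\bar x,\,x\in D}\langle v,x-\bar x\rangle/\|x-\bar x\|\le 0\}$, and the limiting (Mordukhovich) normal cone $N_D(\bar x)$ is the set of all $v$ for which there exist $x_k\in D$, $x_k\to\bar x$, and $v_k\in\widehat N_D(x_k)$ with $v_k\to v$. Normal cone at infinity: for an unbounded closed set $\Omega\subset\mathbb{R}^n$, $N_\Omega(\infty)$ is the set of all $v\in\mathbb{R}^n$ for which there exist $x_k\in\Omega$ with $\|x_k\|\to\infty$ and $v_k\in\widehat N_\Omega(x_k)$ with $v_k\to v$. Limiting subdifferential at infinity: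 for a lower semicontinuous $f:\mathbb{R}^n\to\mathbb{R}$, $\partial f(\infty)$ is the set of all $u\in\mathbb{R}^n$ for which there exist $x_k\in\mathbb{R}^n$ with $\|x_k\|\to\infty$ and $w_k\in N_{\mathrm{epi} f}(x_k,f(x_k))$ with $w_k\to(u,-1)$. *)

theory Defs
  imports "HOL-Analysis.Analysis"
begin

definition lower_semicontinuous :: "('a::topological_space \<Rightarrow> real) \<Rightarrow> bool" where
  "lower_semicontinuous f \<longleftrightarrow> (\<forall>x. ereal (f x) \<le> Liminf (at x) (\<lambda>y. ereal (f y)))"

definition lipschitz_at_infinity :: "('a::euclidean_space \<Rightarrow> real) \<Rightarrow> bool" where
  "lipschitz_at_infinity f \<longleftrightarrow>
     (\<exists>L>0. \<exists>R>0. \<forall>x\<in>- cball 0 R. \<forall>x'\<in>- cball 0 R. \<bar>f x - f x'\<bar> \<le> L * norm (x - x'))"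

(* Only meaningful for xbar in D.  At an isolated point of D the filter is bot,
   the Limsup is minus infinity, and the cone is the whole space, as it should be. *)
definition frechet_normal_cone :: "'a::euclidean_space set \<Rightarrow> 'a \<Rightarrow> 'a set" where
  "frechet_normal_cone D xbar =
     {v. Limsup (at xbar within D) (\<lambda>x. ereal (inner v (x - xbar) / norm (x - xbar))) \<le> 0}"

definition limiting_normal_cone :: "'a::euclidean_space set \<Rightarrow> 'a \<Rightarrow> 'a set" where
  "limiting_normal_cone D xbar =
     {v. \<exists>x w. (\<forall>k::nat. x k \<in> D) \<and> x \<longlonglongrightarrow> xbar
           \<and> (\<forall>k. w k \<in> frechet_normal_cone D (x k)) \<and> w \<longlonglongrightarrow> v}"

definition normal_cone_at_infinity :: "'a::euclidean_space set \<Rightarrow> 'a set" where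
  "normal_cone_at_infinity \<Omega> =
     {v. \<exists>x w. (\<forall>k::nat. x k \<in> \<Omega>) \<and> filterlim (\<lambda>k. norm (x k)) at_top sequentially
           \<and> (\<forall>k. w k \<in> frechet_normal_cone \<Omega> (x k)) \<and> w \<longlonglongrightarrow> v}"

definition subdifferential_at_infinity :: "('a::euclidean_space \<Rightarrow> real) \<Rightarrow> 'a set" where
  "subdifferential_at_infinity f =
     {u. \<exists>x w. filterlim (\<lambda>k::nat. norm (x k)) at_top sequentially
           \<and> (\<forall>k. w k \<in> limiting_normal_cone (epigraph UNIV f) (x k, f (x k)))
           \<and> w \<longlonglongrightarrow> (u, - 1)}"

definition pos_combinations :: "'i set \<Rightarrow> ('i \<Rightarrow> 'a::real_vector set) \<Rightarrow> 'a set" where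
  "pos_combinations J D =
     {\<Sum>j\<in>J. \<beta> j *\<^sub>R v j |\<beta> v. \<forall>j\<in>J. \<beta> j \<ge> 0 \<and> v j \<in> D j}"

definition feasible_set :: "'a set \<Rightarrow> 'i set \<Rightarrow> ('i \<Rightarrow> 'a \<Rightarrow> real) \<Rightarrow> 'a set" where
  "feasible_set \<Omega> J g = {x \<in> \<Omega>. \<forall>j\<in>J. g j x \<le> 0}"

(* Only meaningful for finite nonempty I. *)
definition max_function :: "'i set \<Rightarrow> ('i \<Rightarrow> 'a \<Rightarrow> real) \<Rightarrow> 'a \<Rightarrow> real" where
  "max_function I f x = (MAX i\<in>I. f i x)"

(* Sums of sets, binary and indexed, are the Minkowski sums of Set_Algebras. *)
definition CQ_at_infinity ::
    "'a::euclidean_space set \<Rightarrow> 'i set \<Rightarrow> ('i \<Rightarrow> 'a \<Rightarrow> real) \<Rightarrow> bool" where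
  "CQ_at_infinity \<Omega> J g \<longleftrightarrow>
     \<not> (\<exists>\<beta>. (\<forall>j\<in>J. \<beta> j \<ge> 0) \<and> (\<Sum>j\<in>J. \<beta> j) > 0
          \<and> 0 \<in> (\<Sum>j\<in>J. (\<lambda>v. \<beta> j *\<^sub>R v) ` subdifferential_at_infinity (g j))
                 + normal_cone_at_infinity \<Omega>)"

definition global_solutions :: "'a set \<Rightarrow> ('a \<Rightarrow> real) \<Rightarrow> 'a set" where
  "global_solutions F \<phi> = {xbar \<in> F. \<phi> xbar = (INF x\<in>F. \<phi> x)}"

end

theory Submission
  imports Defs
begin

text \<open>Suppose that the solution set is empty or not compact. Lower semicontinuity makes the
sublevel sets of the maximum \<open>\<phi>\<close> on the feasible set closed, so a bounded sublevel set above
the infimum \<open>c\<close> would give a nonempty compact solution set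
(\<open>global_solutions_compact_if_sublevel_bounded\<close>). Hence there are feasible points with norm
tending to infinity along which \<open>\<phi>\<close> tends to \<open>c\<close>.

The constraints are absorbed into the objective by passing to the maximum \<open>\<psi>\<close> of the functions
\<open>f i - c\<close> and \<open>g j\<close>: it is nonnegative on all of \<open>\<Omega>\<close>, and the escaping points \<open>z\<close> satisfy
\<open>\<psi> z \<le> \<epsilon>\<close> with \<open>\<epsilon>\<close> tending to \<open>0\<close>. So \<open>z\<close> almost minimizes \<open>\<psi>\<close> over \<open>\<Omega>\<close>, and a multiplier rule at
infinity (\<open>multiplier_rule_at_infinity\<close>) yields weights \<open>\<mu> l \<ge> 0\<close> with sum 1 and limiting
subgradients \<open>v l\<close> at infinity such that \<open>- (\<Sum>l. \<mu> l *\<^sub>R v l)\<close> is normal to \<open>\<Omega>\<close> at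
infinity. If all the weights of the \<open>f i\<close> vanish, this contradicts the constraint
qualification; otherwise division by their sum contradicts the last hypothesis.

The multiplier rule comes from minimizing one penalized function near each far point \<open>z\<close>, where
all the functions are Lipschitz with one constant. The maximum is replaced by \<open>ln (\<Sum>l. exp (r * a l)) / r\<close>,
which is smooth with positive partial derivatives, each function gets its own point \<open>X l\<close>,
and the penalty \<open>r * (\<Sum>l. (norm (X l - y))\<^sup>2)\<close> ties these points to
\<open>y\<close> in \<open>\<Omega>\<close>; the term \<open>(norm (y - z))\<^sup>2\<close> keeps
\<open>y\<close> near \<open>z\<close>. A minimizer exists by compactness, and it is optimal in each of its
points separately (\<open>approximate_multiplier_rule\<close>). Optimality in \<open>X l\<close> says that a
multiple of \<open>y - X l\<close> is a proximal subgradient of the function with index \<open>l\<close>, and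
optimality in \<open>y\<close> gives a proximal normal to \<open>\<Omega>\<close>. Since every
\<open>\<mu> l\<close> is positive, every function receives a subgradient, also if it is inactive or its weight tends to
zero; a positive combination has to select one for every constraint.\<close>

section \<open>Normal cones and proximal subgradients\<close>

lemma frechet_normal_cone_iff:
  "v \<in> frechet_normal_cone D x \<longleftrightarrow>
     (\<forall>e>0. \<forall>\<^sub>F y in at x within D. v \<bullet> (y - x) / norm (y - x) < e)"
  (is "_ \<longleftrightarrow> ?R")
proof
  assume "v \<in> frechet_normal_cone D x"
  then have *: "\<forall>c>0. \<forall>\<^sub>F y in at x within D. ereal (v \<bullet> (y - x) / norm (y - x)) < c"
    by (simp add: frechet_normal_cone_def Limsup_le_iff)
  show ?R
  proof (intro allI impI)
    fix e :: real assume "e > 0"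
    then show "\<forall>\<^sub>F y in at x within D. v \<bullet> (y - x) / norm (y - x) < e"
      using *[rule_format, of "ereal e"] by simp
  qed
next
  assume R: ?R
  have "\<forall>\<^sub>F y in at x within D. ereal (v \<bullet> (y - x) / norm (y - x)) < c" if "c > 0" for c :: ereal
    using that R by (cases c) auto
  then show "v \<in> frechet_normal_cone D x"
    by (simp add: frechet_normal_cone_def Limsup_le_iff)
qed

lemma frechet_normal_cone_scaleR:
  assumes "v \<in> frechet_normal_cone D x" "c > 0"
  shows "c *\<^sub>R v \<in> frechet_normal_cone D x"
  unfolding frechet_normal_cone_iff
proof (intro allI impI)
  fix e :: real assume "e > 0"
  then have "\<forall>\<^sub>F y in at x within D. v \<bullet> (y - x) / norm (y - x) < e / c"
    using assms by (simp add: frechet_normal_cone_iff)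
  then show "\<forall>\<^sub>F y in at x within D. c *\<^sub>R v \<bullet> (y - x) / norm (y - x) < e"
    by eventually_elim (use \<open>c > 0\<close> in \<open>simp add: field_simps\<close>)
qed

lemma normal_cone_at_infinity_scaleR:
  assumes "v \<in> normal_cone_at_infinity D" "c > 0"
  shows "c *\<^sub>R v \<in> normal_cone_at_infinity D"
proof -
  obtain x w where xw: "\<forall>k::nat. x k \<in> D" "filterlim (\<lambda>k. norm (x k)) at_top sequentially"
      "\<forall>k. w k \<in> frechet_normal_cone D (x k)" "w \<longlonglongrightarrow> v"
    using assms(1) unfolding normal_cone_at_infinity_def by blast
  have "(\<lambda>k. c *\<^sub>R w k) \<longlonglongrightarrow> c *\<^sub>R v"
    using xw(4) by (intro tendsto_intros)
  moreover have "\<forall>k. c *\<^sub>R w k \<in> frechet_normal_cone D (x k)"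
    using xw(3) assms(2) frechet_normal_cone_scaleR by blast
  ultimately show ?thesis
    using xw(1,2) unfolding normal_cone_at_infinity_def
    by (intro CollectI exI[of _ x] exI[of _ "\<lambda>k. c *\<^sub>R w k"] conjI)
qed

lemma frechet_normal_cone_if_proximal:
  assumes "\<forall>\<^sub>F y in at x within D. v \<bullet> (y - x) \<le> C * (norm (y - x))\<^sup>2"
  shows "v \<in> frechet_normal_cone D x"
  unfolding frechet_normal_cone_iff
proof (intro allI impI)
  fix e :: real assume e: "e > 0"
  have "\<forall>\<^sub>F y in at x within D. y \<in> D \<and> y \<noteq> x \<and> dist y x < e / (\<bar>C\<bar> + 1)"
    using e by (auto simp: eventually_at intro!: exI[of _ "e / (\<bar>C\<bar> + 1)"] divide_pos_pos)
  with assms show "\<forall>\<^sub>F y in at x within D. v \<bullet> (y - x) / norm (y - x) < e"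
  proof eventually_elim
    case (elim y)
    then have n: "norm (y - x) > 0" by simp
    have "v \<bullet> (y - x) / norm (y - x) \<le> C * norm (y - x)"
      using elim(1) n by (simp add: field_simps power2_eq_square)
    also have "\<dots> \<le> (\<bar>C\<bar> + 1) * norm (y - x)"
      by (intro mult_right_mono) auto
    also have "\<dots> < e"
      using elim(2) by (simp add: dist_norm field_simps)
    finally show ?case .
  qed
qed

text \<open>The quadratic error term makes this stronger than a Frechet subgradient. It is what
optimality yields here, since the perturbations below are smooth with errors of second order.\<close>

definition proximal_subgradient :: "('a::euclidean_space \<Rightarrow> real) \<Rightarrow> 'a \<Rightarrow> 'a \<Rightarrow> bool" where
  "proximal_subgradient h x v \<longleftrightarrow>
     (\<exists>C. \<forall>\<^sub>F y in nhds x. h x + v \<bullet> (y - x) - C * (norm (y - x))\<^sup>2 \<le> h y)"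

lemma proximal_subgradient_diff_const:
  "proximal_subgradient (\<lambda>y. h y - c) x v \<longleftrightarrow> proximal_subgradient h x v"
  by (simp add: proximal_subgradient_def diff_diff_eq algebra_simps)

text \<open>The quadratic minorant of \<open>h\<close> that touches at \<open>x\<close> lies below the whole epigraph near
\<open>(x, h x)\<close>, so its downward normal is a proximal normal to the epigraph.\<close>

lemma proximal_subgradient_limiting_normal:
  assumes "proximal_subgradient h x v"
  shows "(v, - 1) \<in> limiting_normal_cone (epigraph UNIV h) (x, h x)"
proof -
  obtain C where C: "\<forall>\<^sub>F y in nhds x. h x + v \<bullet> (y - x) - C * (norm (y - x))\<^sup>2 \<le> h y"
    using assms unfolding proximal_subgradient_def by blast
  have "filterlim fst (nhds x) (at (x, h x) within epigraph UNIV h)"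
    using tendsto_fst[OF tendsto_ident_at, of "(x, h x)" "epigraph UNIV h"] by simp
  then have "\<forall>\<^sub>F z in at (x, h x) within epigraph UNIV h.
      h x + v \<bullet> (fst z - x) - C * (norm (fst z - x))\<^sup>2 \<le> h (fst z)"
    using C by (rule eventually_compose_filterlim[rotated])
  moreover have "\<forall>\<^sub>F z in at (x, h x) within epigraph UNIV h. z \<in> epigraph UNIV h"
    by (simp add: eventually_at_filter)
  ultimately have "\<forall>\<^sub>F z in at (x, h x) within epigraph UNIV h.
      (v, -1) \<bullet> (z - (x, h x)) \<le> \<bar>C\<bar> * (norm (z - (x, h x)))\<^sup>2"
  proof eventually_elim
    case (elim z)
    obtain y a where z: "z = (y, a)" by (cases z)
    have "C * (norm (y - x))\<^sup>2 \<le> \<bar>C\<bar> * (norm (y - x))\<^sup>2"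
      by (intro mult_right_mono) auto
    also have "\<dots> \<le> \<bar>C\<bar> * (norm (z - (x, h x)))\<^sup>2"
      by (intro mult_left_mono) (auto simp: z norm_Pair)
    finally show ?case using elim by (simp add: z mem_epigraph)
  qed
  then have "(v, - 1) \<in> frechet_normal_cone (epigraph UNIV h) (x, h x)"
    by (rule frechet_normal_cone_if_proximal)
  then show ?thesis
    unfolding limiting_normal_cone_def
    by (intro CollectI exI[of _ "\<lambda>_. (x, h x)"] exI[of _ "\<lambda>_. (v, -1)"]) (simp add: mem_epigraph)
qed

text \<open>Along the ray from \<open>x\<close> in direction \<open>v\<close>, the function grows at least at rate
\<open>(norm v)\<^sup>2\<close> and at most at rate \<open>L * norm v\<close>. This bound is what makes the subgradients of
functions that are Lipschitz at infinity converge along a subsequence.\<close>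

lemma proximal_subgradient_norm_le:
  assumes sub: "proximal_subgradient h x v" and "L \<ge> 0"
    and lip: "\<forall>\<^sub>F y in nhds x. h y - h x \<le> L * norm (y - x)"
  shows "norm v \<le> L"
proof (cases "v = 0")
  case True
  with \<open>L \<ge> 0\<close> show ?thesis by simp
next
  case False
  obtain C where C: "\<forall>\<^sub>F y in nhds x. h x + v \<bullet> (y - x) - C * (norm (y - x))\<^sup>2 \<le> h y"
    using sub unfolding proximal_subgradient_def by blast
  have lim: "((\<lambda>t. x + t *\<^sub>R v) \<longlongrightarrow> x) (at_right 0)"
    by (rule tendsto_eq_intros refl | simp)+
  have "\<forall>\<^sub>F t in at_right (0::real). 0 < t"
    by (simp add: eventually_at_right_less)
  then have "\<forall>\<^sub>F t in at_right 0. norm v ^ 2 - C * t * norm v ^ 2 \<le> L * norm v"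
    using eventually_compose_filterlim[OF C lim] eventually_compose_filterlim[OF lip lim]
  proof eventually_elim
    case (elim t)
    have "t * (norm v ^ 2 - C * t * norm v ^ 2) \<le> t * (L * norm v)"
      using elim by (simp add: power_mult_distrib power2_norm_eq_inner algebra_simps power2_eq_square[of t])
    with elim(1) show ?case by (simp only: mult_le_cancel_left_pos)
  qed
  moreover have "((\<lambda>t. norm v ^ 2 - C * t * norm v ^ 2) \<longlongrightarrow> norm v ^ 2) (at_right 0)"
    by (rule tendsto_eq_intros refl | simp)+
  ultimately have "norm v ^ 2 \<le> L * norm v"
    by (intro tendsto_upperbound) auto
  with False show ?thesis by (simp add: power2_eq_square)
qed

section \<open>The smooth maximum\<close>

lemma exp_le_quadratic:
  fixes x :: real
  assumes "\<bar>x\<bar> \<le> 1"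
  shows "exp x \<le> 1 + x + x\<^sup>2"
proof (cases "x \<ge> 0")
  case True
  then show ?thesis using assms exp_bound by auto
next
  case False
  have "1 - x \<le> exp (- x)" using exp_ge_add_one_self[of "- x"] by simp
  then have "exp x \<le> 1 / (1 - x)"
    using False by (simp add: exp_minus field_simps)
  also have "\<dots> \<le> 1 + x + x\<^sup>2"
  proof -
    have "(1 + x + x\<^sup>2) * (1 - x) = 1 + x\<^sup>2 * (- x)"
      by (simp add: algebra_simps power2_eq_square)
    also have "\<dots> \<ge> 1" using False by (simp add: mult_nonneg_nonpos)
    finally show ?thesis using False by (simp add: pos_divide_le_eq)
  qed
  finally show ?thesis .
qed

text \<open>The factor in front is the derivative of the smooth maximum in one of its arguments, \<open>T\<close>
being the contribution of the other ones. The error is quadratic in the increment \<open>s\<close>, so that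
it preserves proximal inequalities.\<close>

lemma log_sum_exp_increment:
  fixes a r s T :: real
  assumes "T \<ge> 0" "\<bar>r * s\<bar> \<le> 1"
  shows "ln (T + exp (r * (a + s))) - ln (T + exp (r * a))
           \<le> exp (r * a) / (T + exp (r * a)) * (r * s + (r * s)\<^sup>2)"
proof -
  let ?W = "T + exp (r * a)"
  have W: "?W > 0" and U: "T + exp (r * (a + s)) > 0"
    using assms by (simp_all add: add_nonneg_pos)
  have "ln (T + exp (r * (a + s))) - ln ?W = ln ((T + exp (r * (a + s))) / ?W)"
    using W U by (simp add: ln_div)
  also have "\<dots> \<le> (T + exp (r * (a + s))) / ?W - 1"
    using W U by (intro ln_le_minus_one) simp
  also have "\<dots> = exp (r * a) / ?W * (exp (r * s) - 1)"
    using W by (simp add: field_simps exp_add)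
  also have "\<dots> \<le> exp (r * a) / ?W * (r * s + (r * s)\<^sup>2)"
    using exp_le_quadratic[OF assms(2)] W by (intro mult_left_mono) auto
  finally show ?thesis .
qed

lemma le_log_sum_exp:
  fixes a :: "'l \<Rightarrow> real"
  assumes "finite S" "l \<in> S" "r > 0"
  shows "a l \<le> ln (\<Sum>l\<in>S. exp (r * a l)) / r"
proof -
  have "exp (r * a l) \<le> (\<Sum>l\<in>S. exp (r * a l))"
    using assms by (intro member_le_sum) auto
  then have "r * a l \<le> ln (\<Sum>l\<in>S. exp (r * a l))"
    by (smt (verit) exp_gt_zero ln_exp ln_le_cancel_iff)
  with \<open>r > 0\<close> show ?thesis by (simp add: field_simps)
qed

lemma log_sum_exp_le:
  fixes a :: "'l \<Rightarrow> real"
  assumes "finite S" "S \<noteq> {}" "r > 0" "\<And>l. l \<in> S \<Longrightarrow> a l \<le> c"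
  shows "ln (\<Sum>l\<in>S. exp (r * a l)) / r \<le> c + ln (card S) / r"
proof -
  have "(\<Sum>l\<in>S. exp (r * a l)) \<le> (\<Sum>l\<in>S. exp (r * c))"
    using assms by (intro sum_mono) simp
  then have "(\<Sum>l\<in>S. exp (r * a l)) \<le> card S * exp (r * c)" by simp
  moreover have "0 < (\<Sum>l\<in>S. exp (r * a l))"
    using assms by (intro sum_pos) auto
  ultimately have "ln (\<Sum>l\<in>S. exp (r * a l)) \<le> ln (card S * exp (r * c))"
    by (subst ln_le_cancel_iff) auto
  also have "\<dots> = ln (card S) + r * c"
    using assms by (subst ln_mult) (auto simp: card_gt_0_iff)
  finally show ?thesis using \<open>r > 0\<close> by (simp add: field_simps)
qed

section \<open>Multipliers at points almost minimizing a maximum\<close>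

text \<open>Minimizing over families of points uses the product topology on functions, in which a
product of copies of a compact set is compact by Tychonoff's theorem.\<close>

lemma compact_Pi_UNIV:
  assumes "compact (C :: 'b::topological_space set)"
  shows "compact (Pi UNIV (\<lambda>_. C) :: ('a \<Rightarrow> 'b) set)"
proof -
  have "compactin (product_topology (\<lambda>_. euclidean) UNIV) (PiE UNIV (\<lambda>_::'a. C))"
    using assms by (subst compactin_PiE) auto
  then show ?thesis
    by (simp add: euclidean_product_topology PiE_UNIV_domain Pi_def)
qed

text \<open>For large \<open>r\<close> the first term of \<open>E\<close> approximates the maximum of the values \<open>h l (X l)\<close> and
the last one forces all the points \<open>X l\<close> towards \<open>y\<close>, so that this is a decoupled version of
minimizing the maximum of the \<open>h l\<close> over \<open>\<Omega>\<close>.\<close>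

lemma penalized_minimizer:
  fixes h :: "'l \<Rightarrow> 'a::euclidean_space \<Rightarrow> real" and r :: real
  assumes "closed \<Omega>" "finite S" "z \<in> \<Omega>"
    and "S \<noteq> {}" and cont: "\<And>l. l \<in> S \<Longrightarrow> continuous_on (cball z 1) (h l)"
  defines "E \<equiv> \<lambda>y X. ln (\<Sum>l\<in>S. exp (r * h l (X l))) / r + (norm (y - z))\<^sup>2
                        + r * (\<Sum>l\<in>S. (norm (X l - y))\<^sup>2)"
  assumes "r > 0"
  obtains y X where "y \<in> \<Omega> \<inter> cball z 1" "\<And>l. X l \<in> cball z 1"
    "\<And>y' X'. y' \<in> \<Omega> \<inter> cball z 1 \<Longrightarrow> (\<And>l. X' l \<in> cball z 1) \<Longrightarrow> E y X \<le> E y' X'"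
proof -
  define K where "K = (\<Omega> \<inter> cball z 1) \<times> (Pi UNIV (\<lambda>_. cball z 1) :: ('l \<Rightarrow> 'a) set)"
  have "compact K"
    unfolding K_def using \<open>closed \<Omega>\<close> by (intro compact_Times closed_Int_compact compact_Pi_UNIV) auto
  moreover have "(z, \<lambda>_. z) \<in> K"
    using \<open>z \<in> \<Omega>\<close> by (auto simp: K_def)
  moreover have "continuous_on K (\<lambda>(y, X). E y X)"
  proof -
    have coord: "continuous_on K (\<lambda>w. snd w l)" for l
      by (rule continuous_on_compose2[OF continuous_on_product_coordinates continuous_on_snd[OF continuous_on_id]]) auto
    have hl: "continuous_on K (\<lambda>w. h l (snd w l))" if "l \<in> S" for l
      by (rule continuous_on_compose2[OF cont[OF that] coord]) (auto simp: K_def)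
    have "0 < (\<Sum>l\<in>S. exp (r * h l (X l)))" for X
      using assms by (intro sum_pos) auto
    then show ?thesis
      unfolding E_def case_prod_beta
      by (intro continuous_intros coord hl) (auto simp: less_imp_neq[symmetric] \<open>r > 0\<close>)
  qed
  ultimately obtain w where w: "w \<in> K" "\<forall>w'\<in>K. (\<lambda>(y, X). E y X) w \<le> (\<lambda>(y, X). E y X) w'"
    using continuous_attains_inf[of K] by blast
  show ?thesis
  proof (rule that[of "fst w" "snd w"])
    show "fst w \<in> \<Omega> \<inter> cball z 1" "snd w l \<in> cball z 1" for l
      using w(1) by (auto simp: K_def Pi_def)
    fix y' and X' :: "'l \<Rightarrow> 'a"
    assume "y' \<in> \<Omega> \<inter> cball z 1" "\<And>l. X' l \<in> cball z 1"
    then have "(y', X') \<in> K" by (auto simp: K_def)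
    with w(2) show "E (fst w) (snd w) \<le> E y' X'" by (auto simp: case_prod_beta)
  qed
qed

lemma norm_diff_square_change:
  fixes a x y :: "'a::real_inner"
  shows "(norm (x - a))\<^sup>2 - (norm (y - a))\<^sup>2 = 2 * ((a - x) \<bullet> (y - x)) - (norm (y - x))\<^sup>2"
  by (simp add: power2_norm_eq_inner algebra_simps inner_commute)

text \<open>The minimizer of the penalized problem lies within \<open>\<eta>\<close> of \<open>z\<close>, because \<open>z\<close> minimizes the
maximum of the \<open>h l\<close> over \<open>\<Omega>\<close> up to \<open>\<eta>\<^sup>2 / 8\<close>. All its points are thus interior to the ball
on which the problem is posed, and the first-order conditions in the separate points give the
subgradients \<open>v l\<close> and the normal vector. What prevents exact stationarity is the gradient
\<open>2 *\<^sub>R (y - z)\<close>, which is at most \<open>2 * \<eta>\<close> in norm.\<close>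

lemma approximate_multiplier_rule:
  fixes h :: "'l \<Rightarrow> 'a::euclidean_space \<Rightarrow> real"
  assumes \<Omega>: "closed \<Omega>" "z \<in> \<Omega>" and S: "finite S" "S \<noteq> {}"
    and \<eta>: "0 < \<eta>" "\<eta> \<le> 1" and "L \<ge> 0"
    and lip: "\<And>l x y. l \<in> S \<Longrightarrow> x \<in> cball z 1 \<Longrightarrow> y \<in> cball z 1 \<Longrightarrow> \<bar>h l x - h l y\<bar> \<le> L * norm (x - y)"
    and nonneg: "\<And>x. x \<in> \<Omega> \<Longrightarrow> \<exists>l\<in>S. 0 \<le> h l x"
    and small: "\<And>l. l \<in> S \<Longrightarrow> h l z \<le> \<eta>\<^sup>2 / 8"
  obtains y X \<mu> v where "y \<in> \<Omega>" "norm (y - z) < \<eta>"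
    "\<And>l. l \<in> S \<Longrightarrow> norm (X l - z) < \<eta>"
    "\<And>l. l \<in> S \<Longrightarrow> 0 < \<mu> l" "(\<Sum>l\<in>S. \<mu> l) = 1"
    "\<And>l. l \<in> S \<Longrightarrow> proximal_subgradient (h l) (X l) (v l)"
    "\<And>l. l \<in> S \<Longrightarrow> norm (v l) \<le> L"
    "- (2 *\<^sub>R (y - z)) - (\<Sum>l\<in>S. \<mu> l *\<^sub>R v l) \<in> frechet_normal_cone \<Omega> y"
proof -
  \<comment> \<open>The penalty \<open>r\<close> must be so large that the two errors of the penalized problem,
    \<open>ln (card S) / r\<close> from replacing the maximum by the smooth one and \<open>L\<^sup>2 / (2 * r)\<close> from
    letting the points differ, add up to less than \<open>\<eta>\<^sup>2 / 8\<close>.\<close>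
  define Q where "Q = ln (card S) + L\<^sup>2 / 2"
  have "Q \<ge> 0"
    using S by (auto simp: Q_def Suc_le_eq card_gt_0_iff intro!: add_nonneg_nonneg ln_ge_zero)
  define r where "r = 2 + 8 * Q / \<eta>\<^sup>2"
  have r: "r \<ge> 2" using \<open>Q \<ge> 0\<close> by (simp add: r_def)
  have Qr: "Q / r < \<eta>\<^sup>2 / 8"
  proof -
    have "\<eta>\<^sup>2 / 8 * r = \<eta>\<^sup>2 / 4 + Q"
      using \<eta> by (simp add: r_def field_simps)
    moreover have "0 < \<eta>\<^sup>2" using \<eta> by simp
    ultimately have "Q < \<eta>\<^sup>2 / 8 * r" by linarith
    then show ?thesis using r by (simp add: pos_divide_less_eq)
  qed
  have "r > 0" using r by simp
  have cont: "continuous_on (cball z 1) (h l)" if "l \<in> S" for l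
    by (rule lipschitz_on_continuous_on[of L], rule lipschitz_onI)
      (use lip[OF that] \<open>L \<ge> 0\<close> in \<open>auto simp: dist_norm\<close>)
  obtain y X where y: "y \<in> \<Omega> \<inter> cball z 1" and X: "\<And>l. X l \<in> cball z 1"
    and min: "\<And>y' X'. y' \<in> \<Omega> \<inter> cball z 1 \<Longrightarrow> (\<And>l. X' l \<in> cball z 1) \<Longrightarrow>
        ln (\<Sum>l\<in>S. exp (r * h l (X l))) / r + (norm (y - z))\<^sup>2 + r * (\<Sum>l\<in>S. (norm (X l - y))\<^sup>2)
      \<le> ln (\<Sum>l\<in>S. exp (r * h l (X' l))) / r + (norm (y' - z))\<^sup>2 + r * (\<Sum>l\<in>S. (norm (X' l - y'))\<^sup>2)"
    by (rule penalized_minimizer[OF \<Omega>(1) S(1) \<Omega>(2) S(2) cont \<open>r > 0\<close>]) blast+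
  define W where "W = (\<Sum>l\<in>S. exp (r * h l (X l)))"
  have "W > 0" using S by (auto simp: W_def intro!: sum_pos)
  define D where "D = (\<Sum>l\<in>S. (norm (X l - y))\<^sup>2)"
  have "D \<ge> 0" by (auto simp: D_def intro!: sum_nonneg)
  have le_D: "(norm (X l - y))\<^sup>2 \<le> D" if "l \<in> S" for l
    unfolding D_def by (rule member_le_sum[OF that]) (use S in auto)

  \<comment> \<open>The value at the minimizer is at most the value at \<open>z\<close>, where all the points coincide; it is
    bounded below because some \<open>h l0\<close> is nonnegative at \<open>y\<close> and hence at least \<open>- L * d\<close> at \<open>X l0\<close>.
    The square terms are therefore small, and no point lies on the boundary of the ball.\<close>
  obtain l0 where l0: "l0 \<in> S" "0 \<le> h l0 y" using nonneg y by blast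
  define d where "d = norm (X l0 - y)"
  have "- (L * d) \<le> h l0 (X l0)"
    using lip[of l0 "X l0" y] l0 X[of l0] y by (auto simp: d_def)
  also have "\<dots> \<le> ln W / r"
    unfolding W_def using S l0 \<open>r > 0\<close> by (intro le_log_sum_exp) auto
  finally have lower: "- (L * d) \<le> ln W / r" .
  have "ln (\<Sum>l\<in>S. exp (r * h l z)) / r \<le> \<eta>\<^sup>2 / 8 + ln (card S) / r"
    using S \<open>r > 0\<close> small by (intro log_sum_exp_le) auto
  then have upper: "ln W / r + (norm (y - z))\<^sup>2 + r * D \<le> \<eta>\<^sup>2 / 8 + ln (card S) / r"
    using min[of z "\<lambda>_. z"] \<Omega> by (simp add: W_def D_def)
  have "0 \<le> (r * d - L)\<^sup>2 / (2 * r)" using \<open>r > 0\<close> by simp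
  also have "\<dots> = r / 2 * d\<^sup>2 + L\<^sup>2 / 2 / r - L * d"
    using \<open>r > 0\<close> by (simp add: field_simps power2_eq_square)
  finally have "L * d \<le> r / 2 * d\<^sup>2 + L\<^sup>2 / 2 / r" by simp
  moreover have "r / 2 * d\<^sup>2 \<le> r / 2 * D"
    using le_D[OF l0(1)] \<open>r > 0\<close> by (intro mult_left_mono) (auto simp: d_def)
  ultimately have "(norm (y - z))\<^sup>2 + r / 2 * D \<le> \<eta>\<^sup>2 / 8 + Q / r"
    using lower upper by (simp add: Q_def add_divide_distrib)
  moreover have "(\<eta> / 2)\<^sup>2 = \<eta>\<^sup>2 / 8 + \<eta>\<^sup>2 / 8"
    by (simp add: power_divide)
  ultimately have bound: "(norm (y - z))\<^sup>2 + r / 2 * D < (\<eta> / 2)\<^sup>2"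
    using Qr by linarith
  have "1 * D \<le> r / 2 * D" using r \<open>D \<ge> 0\<close> by (intro mult_right_mono) auto
  with bound have "D < (\<eta> / 2)\<^sup>2" "(norm (y - z))\<^sup>2 < (\<eta> / 2)\<^sup>2"
    using \<open>D \<ge> 0\<close> zero_le_power2[of "norm (y - z)"] by linarith+
  then have y_near: "norm (y - z) < \<eta> / 2"
    using \<eta> by (intro power2_less_imp_less[of _ "\<eta> / 2"]) simp_all
  have X_near_y: "norm (X l - y) < \<eta> / 2" if "l \<in> S" for l
    using \<eta> le_D[OF that] \<open>D < (\<eta> / 2)\<^sup>2\<close>
    by (intro power2_less_imp_less[of _ "\<eta> / 2"]) (linarith, simp)
  have X_near: "norm (X l - z) < \<eta>" if "l \<in> S" for l
    using y_near X_near_y[OF that] norm_triangle_ineq[of "X l - y" "y - z"] by simp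

  \<comment> \<open>The multipliers are the partial derivatives of the smooth maximum, and \<open>\<mu> l *\<^sub>R v l\<close> is minus
    the gradient of the penalty in \<open>X l\<close>.\<close>
  define \<mu> where "\<mu> l = exp (r * h l (X l)) / W" for l
  have \<mu>_pos: "\<mu> l > 0" for l using \<open>W > 0\<close> by (simp add: \<mu>_def)
  have \<mu>_sum: "(\<Sum>l\<in>S. \<mu> l) = 1"
    using \<open>W > 0\<close> by (simp add: \<mu>_def W_def flip: sum_divide_distrib)
  define v where "v l = (2 * r / \<mu> l) *\<^sub>R (y - X l)" for l
  have \<mu>v: "\<mu> l *\<^sub>R v l = (2 * r) *\<^sub>R (y - X l)" for l
    using \<mu>_pos[of l] by (simp add: v_def)

  have in_ball: "\<forall>\<^sub>F x in nhds (X l). x \<in> ball z 1" if "l \<in> S" for l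
    using X_near[OF that] \<eta> by (intro eventually_nhds_in_open) (auto simp: dist_norm norm_minus_commute)

  \<comment> \<open>Only the point with index \<open>l\<close> is moved.\<close>
  have sub: "proximal_subgradient (h l) (X l) (v l)" if l: "l \<in> S" for l
    unfolding proximal_subgradient_def
  proof (rule exI[of _ "r / \<mu> l + r * L\<^sup>2"])
    have "\<forall>\<^sub>F x in nhds (X l). dist x (X l) < 1 / (r * L + 1)"
      using \<open>r > 0\<close> \<open>L \<ge> 0\<close> by (intro eventually_nhds_in_open[of "ball (X l) _", simplified, THEN eventually_mono])
        (auto simp: dist_commute add_nonneg_pos)
    then show "\<forall>\<^sub>F x in nhds (X l). h l (X l) + v l \<bullet> (x - X l)
        - (r / \<mu> l + r * L\<^sup>2) * (norm (x - X l))\<^sup>2 \<le> h l x"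
      using in_ball[OF l]
    proof eventually_elim
      case (elim x)
      define s where "s = h l x - h l (X l)"
      define n where "n = norm (x - X l)"
      define T where "T = (\<Sum>l\<in>S - {l}. exp (r * h l (X l)))"
      have "T \<ge> 0" by (auto simp: T_def intro!: sum_nonneg)
      have W: "W = T + exp (r * h l (X l))"
        using S l by (simp add: W_def T_def sum.remove[of S l])
      have s: "\<bar>s\<bar> \<le> L * n"
        using lip[OF l, of x "X l"] elim(2) X[of l] by (auto simp: s_def n_def)
      have "n \<ge> 0" by (simp add: n_def)
      have "n * (r * L + 1) < 1"
        using elim(1) \<open>r > 0\<close> \<open>L \<ge> 0\<close> by (simp add: n_def dist_norm pos_less_divide_eq add_nonneg_pos)
      then have "r * (L * n) \<le> 1" using \<open>n \<ge> 0\<close> by (simp add: algebra_simps)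
      moreover have "r * \<bar>s\<bar> \<le> r * (L * n)" using s \<open>r > 0\<close> by simp
      ultimately have "r * \<bar>s\<bar> \<le> 1" by linarith
      then have rs: "\<bar>r * s\<bar> \<le> 1" using \<open>r > 0\<close> by (simp add: abs_mult)
      have opt: "ln W / r + (norm (y - z))\<^sup>2 + r * D
          \<le> ln (\<Sum>k\<in>S. exp (r * h k ((X(l := x)) k))) / r + (norm (y - z))\<^sup>2
              + r * (\<Sum>k\<in>S. (norm ((X(l := x)) k - y))\<^sup>2)"
        unfolding W_def D_def using y X elim(2) by (intro min) auto
      have sum_exp: "(\<Sum>k\<in>S. exp (r * h k ((X(l := x)) k))) = T + exp (r * h l x)"
        using S l by (simp add: T_def sum.remove[of S l])
      have sum_sq: "(\<Sum>k\<in>S. (norm ((X(l := x)) k - y))\<^sup>2) = D - (norm (X l - y))\<^sup>2 + (norm (x - y))\<^sup>2"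
        using S l by (simp add: D_def sum.remove[of S l])
      have "r * ((norm (X l - y))\<^sup>2 - (norm (x - y))\<^sup>2) \<le> (ln (T + exp (r * h l x)) - ln W) / r"
        using opt unfolding sum_exp sum_sq by (simp add: algebra_simps diff_divide_distrib)
      also have "\<dots> \<le> \<mu> l * (r * s + (r * s)\<^sup>2) / r"
        using log_sum_exp_increment[OF \<open>T \<ge> 0\<close> rs, of "h l (X l)"] \<open>r > 0\<close>
        by (intro divide_right_mono) (simp_all add: \<mu>_def W s_def)
      also have "\<dots> = \<mu> l * (s + r * s\<^sup>2)"
        using \<open>r > 0\<close> by (simp add: field_simps power2_eq_square)
      finally have "\<mu> l * (v l \<bullet> (x - X l)) - r * n\<^sup>2 \<le> \<mu> l * (s + r * s\<^sup>2)"
        using arg_cong[OF \<mu>v[of l], of "\<lambda>w. w \<bullet> (x - X l)"]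
        by (simp add: norm_diff_square_change n_def right_diff_distrib)
      moreover have "\<mu> l * (v l \<bullet> (x - X l)) - r * n\<^sup>2 = \<mu> l * (v l \<bullet> (x - X l) - r / \<mu> l * n\<^sup>2)"
        using \<mu>_pos[of l] by (simp add: field_simps)
      ultimately have "v l \<bullet> (x - X l) - r / \<mu> l * n\<^sup>2 \<le> s + r * s\<^sup>2"
        using \<mu>_pos[of l] by (simp only: mult_le_cancel_left_pos)
      moreover have "s\<^sup>2 \<le> L\<^sup>2 * n\<^sup>2"
        using power_mono[OF s, of 2] by (simp add: power_mult_distrib)
      then have "r * s\<^sup>2 \<le> r * L\<^sup>2 * n\<^sup>2" using \<open>r > 0\<close> by (simp add: mult.assoc)
      ultimately show ?case by (simp add: s_def n_def algebra_simps)
    qed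
  qed

  have v_le: "norm (v l) \<le> L" if l: "l \<in> S" for l
  proof (rule proximal_subgradient_norm_le[OF sub[OF l] \<open>L \<ge> 0\<close>])
    show "\<forall>\<^sub>F x in nhds (X l). h l x - h l (X l) \<le> L * norm (x - X l)"
      using in_ball[OF l]
    proof eventually_elim
      case (elim x)
      then show ?case using lip[OF l, of x "X l"] X[of l] by (auto simp: abs_le_iff)
    qed
  qed

  \<comment> \<open>Now only \<open>y\<close> is moved, so the smooth maximum stays constant: \<open>u\<close> is minus the gradient of
    the remaining quadratic function of \<open>y\<close>, which \<open>y\<close> minimizes over \<open>\<Omega>\<close> near itself.\<close>
  define u where "u = - (2 *\<^sub>R (y - z)) - (\<Sum>l\<in>S. \<mu> l *\<^sub>R v l)"
  have "\<forall>\<^sub>F y' in nhds y. y' \<in> ball z 1"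
    using y_near \<eta> by (intro eventually_nhds_in_open) (auto simp: dist_norm norm_minus_commute)
  then have "\<forall>\<^sub>F y' in at y within \<Omega>. y' \<in> \<Omega> \<inter> cball z 1"
    by (auto simp: eventually_at_filter elim!: eventually_mono)
  then have "\<forall>\<^sub>F y' in at y within \<Omega>. u \<bullet> (y' - y) \<le> (1 + r * card S) * (norm (y' - y))\<^sup>2"
  proof eventually_elim
    case (elim y')
    have "(norm (y - z))\<^sup>2 + r * (\<Sum>l\<in>S. (norm (X l - y))\<^sup>2)
        \<le> (norm (y' - z))\<^sup>2 + r * (\<Sum>l\<in>S. (norm (X l - y'))\<^sup>2)"
      using min[of y' X, OF elim X] by simp
    then have "((norm (y - z))\<^sup>2 - (norm (y' - z))\<^sup>2)
        + r * (\<Sum>l\<in>S. (norm (y - X l))\<^sup>2 - (norm (y' - X l))\<^sup>2) \<le> 0"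
      by (simp add: sum_subtractf algebra_simps norm_minus_commute)
    then have "2 * ((z - y) \<bullet> (y' - y)) - (norm (y' - y))\<^sup>2
        + r * ((\<Sum>l\<in>S. 2 * ((X l - y) \<bullet> (y' - y))) - card S * (norm (y' - y))\<^sup>2) \<le> 0"
      by (simp only: norm_diff_square_change sum_subtractf sum_constant)
    moreover have "(\<Sum>l\<in>S. \<mu> l *\<^sub>R v l) \<bullet> (y' - y) = (\<Sum>l\<in>S. - (r * (2 * ((X l - y) \<bullet> (y' - y)))))"
      unfolding inner_sum_left \<mu>v by (intro sum.cong refl) (simp add: inner_diff_left algebra_simps)
    then have "u \<bullet> (y' - y) = 2 * ((z - y) \<bullet> (y' - y)) + r * (\<Sum>l\<in>S. 2 * ((X l - y) \<bullet> (y' - y)))"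
      by (simp only: u_def inner_diff_left[of _ "\<Sum>l\<in>S. _ l"] sum_negf sum_distrib_left)
        (simp add: inner_diff_left algebra_simps)
    ultimately show ?case by (simp add: algebra_simps)
  qed
  then have "u \<in> frechet_normal_cone \<Omega> y" by (rule frechet_normal_cone_if_proximal)
  then show thesis
    using that[of y X \<mu> v] y y_near X_near \<eta> \<mu>_pos \<mu>_sum sub v_le unfolding u_def by auto
qed

section \<open>The multiplier rule at infinity\<close>

lemma uniformly_lipschitz_at_infinity:
  fixes h :: "'l \<Rightarrow> 'a::euclidean_space \<Rightarrow> real"
  assumes "finite S" "\<And>l. l \<in> S \<Longrightarrow> lipschitz_at_infinity (h l)"
  obtains L R where "L \<ge> 0" "R \<ge> 0"
    "\<And>l x y. l \<in> S \<Longrightarrow> R < norm x \<Longrightarrow> R < norm y \<Longrightarrow> \<bar>h l x - h l y\<bar> \<le> L * norm (x - y)"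
proof -
  have "\<forall>l\<in>S. \<exists>w. 0 < fst w \<and> 0 < snd w \<and>
      (\<forall>x\<in>- cball 0 (snd w). \<forall>y\<in>- cball 0 (snd w). \<bar>h l x - h l y\<bar> \<le> fst w * norm (x - y))"
    using assms(2) unfolding lipschitz_at_infinity_def by fastforce
  from bchoice[OF this] obtain w where w: "\<And>l. l \<in> S \<Longrightarrow> 0 < fst (w l)" "\<And>l. l \<in> S \<Longrightarrow> 0 < snd (w l)"
    "\<And>l x y. l \<in> S \<Longrightarrow> x \<in> - cball 0 (snd (w l)) \<Longrightarrow> y \<in> - cball 0 (snd (w l)) \<Longrightarrow> \<bar>h l x - h l y\<bar> \<le> fst (w l) * norm (x - y)"
    by blast
  show thesis
  proof (rule that[of "\<Sum>l\<in>S. fst (w l)" "\<Sum>l\<in>S. snd (w l)"])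
    show "0 \<le> (\<Sum>l\<in>S. fst (w l))" "0 \<le> (\<Sum>l\<in>S. snd (w l))"
      by (simp_all add: sum_nonneg less_imp_le w)
    fix l and x y :: 'a assume l: "l \<in> S" and xy: "(\<Sum>l\<in>S. snd (w l)) < norm x" "(\<Sum>l\<in>S. snd (w l)) < norm y"
    have "snd (w l) \<le> (\<Sum>l\<in>S. snd (w l))" "fst (w l) \<le> (\<Sum>l\<in>S. fst (w l))"
      by (intro member_le_sum l assms(1); simp add: less_imp_le w)+
    then have "\<bar>h l x - h l y\<bar> \<le> fst (w l) * norm (x - y)"
      using l xy by (intro w(3)) auto
    also have "\<dots> \<le> (\<Sum>l\<in>S. fst (w l)) * norm (x - y)"
      using \<open>fst (w l) \<le> _\<close> by (intro mult_right_mono) auto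
    finally show "\<bar>h l x - h l y\<bar> \<le> (\<Sum>l\<in>S. fst (w l)) * norm (x - y)" .
  qed
qed

text \<open>Approximate multiplier rules along a sequence escaping to infinity pass to the limit: the
multipliers lie in \<open>{0..1}\<close>, the subgradients are bounded by the common Lipschitz constant, and
the base points of all subgradients and normals stay within distance 1 of the sequence. The
levels \<open>c l\<close> allow functions to be shifted by constants, which leaves their proximal
subgradients unchanged.\<close>

lemma multiplier_rule_at_infinity:
  fixes h :: "'l::countable \<Rightarrow> 'a::euclidean_space \<Rightarrow> real" and c :: "'l \<Rightarrow> real"
  assumes \<Omega>: "closed \<Omega>" and S: "finite S" "S \<noteq> {}"
    and lip: "\<And>l. l \<in> S \<Longrightarrow> lipschitz_at_infinity (h l)"
    and level: "\<And>x. x \<in> \<Omega> \<Longrightarrow> \<exists>l\<in>S. c l \<le> h l x"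
    and escape: "\<And>e \<rho>. 0 < e \<Longrightarrow> \<exists>x\<in>\<Omega>. \<rho> < norm x \<and> (\<forall>l\<in>S. h l x < c l + e)"
  obtains \<mu> v where "\<And>l. l \<in> S \<Longrightarrow> 0 \<le> \<mu> l" "(\<Sum>l\<in>S. \<mu> l) = 1"
    "\<And>l. l \<in> S \<Longrightarrow> v l \<in> subdifferential_at_infinity (h l)"
    "- (\<Sum>l\<in>S. \<mu> l *\<^sub>R v l) \<in> normal_cone_at_infinity \<Omega>"
proof -
  obtain L R where L: "L \<ge> 0" and R: "R \<ge> 0" and unif: "\<And>l x y. l \<in> S \<Longrightarrow> R < norm x \<Longrightarrow> R < norm y
      \<Longrightarrow> \<bar>h l x - h l y\<bar> \<le> L * norm (x - y)"
    by (rule uniformly_lipschitz_at_infinity[of S h, OF S(1) lip]) metis+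
  define \<eta> where "\<eta> k = 1 / real (Suc k)" for k
  have \<eta>: "0 < \<eta> k" "\<eta> k \<le> 1" for k by (auto simp: \<eta>_def)
  have "\<eta> \<longlonglongrightarrow> 0" unfolding \<eta>_def by (rule LIMSEQ_Suc[OF lim_1_over_n])
  \<comment> \<open>\<open>q\<close> stands for minus the gradient of the quadratic perturbation, which vanishes in the
    limit.\<close>
  define approx where "approx k y X \<mu> v q \<longleftrightarrow> y \<in> \<Omega> \<and> real k \<le> norm y \<and> (\<forall>l\<in>S. real k \<le> norm (X l)) \<and>
      (\<forall>l\<in>S. 0 < \<mu> l) \<and> (\<Sum>l\<in>S. \<mu> l) = 1 \<and> (\<forall>l\<in>S. proximal_subgradient (h l) (X l) (v l)) \<and>
      (\<forall>l\<in>S. norm (v l) \<le> L) \<and> norm q \<le> 2 * \<eta> k \<and>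
      q - (\<Sum>l\<in>S. \<mu> l *\<^sub>R v l) \<in> frechet_normal_cone \<Omega> y" for k y X \<mu> v q
  have "\<exists>y X \<mu> v q. approx k y X \<mu> v q" for k
  proof -
    have "0 < (\<eta> k)\<^sup>2 / 8" using \<eta>[of k] by simp
    from escape[OF this, of "real k + R + 2"] obtain z where z: "z \<in> \<Omega>" "real k + R + 2 < norm z"
      and z_low: "\<And>l. l \<in> S \<Longrightarrow> h l z < c l + (\<eta> k)\<^sup>2 / 8"
      by blast
    have small: "h l z - c l \<le> (\<eta> k)\<^sup>2 / 8" if "l \<in> S" for l
      using z_low[OF that] by linarith
    have nonneg: "\<exists>l\<in>S. 0 \<le> h l x - c l" if "x \<in> \<Omega>" for x
      using level[OF that] by simp
    have far: "real k + R + 1 < norm x" if "norm (x - z) \<le> 1" for x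
      using that z(2) norm_triangle_sub[of z x] by (simp add: norm_minus_commute)
    have lipz: "\<bar>(h l x - c l) - (h l y - c l)\<bar> \<le> L * norm (x - y)" if "l \<in> S" "x \<in> cball z 1" "y \<in> cball z 1" for l x y
      using far[of x] far[of y] that unif[of l x y] by (simp add: dist_norm norm_minus_commute)
    obtain y X \<mu> v where *: "y \<in> \<Omega>" "norm (y - z) < \<eta> k"
      "\<And>l. l \<in> S \<Longrightarrow> norm (X l - z) < \<eta> k"
      "\<And>l. l \<in> S \<Longrightarrow> 0 < \<mu> l" "(\<Sum>l\<in>S. \<mu> l) = 1"
      "\<And>l. l \<in> S \<Longrightarrow> proximal_subgradient (\<lambda>x. h l x - c l) (X l) (v l)"
      "\<And>l. l \<in> S \<Longrightarrow> norm (v l) \<le> L"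
      "- (2 *\<^sub>R (y - z)) - (\<Sum>l\<in>S. \<mu> l *\<^sub>R v l) \<in> frechet_normal_cone \<Omega> y"
      by (rule approximate_multiplier_rule[OF \<Omega> z(1) S \<eta>(1)[of k] \<eta>(2)[of k] L lipz nonneg small]) (assumption | rule that)+
    have "real k \<le> norm y" using far[of y] *(2) \<eta>(2)[of k] R by simp
    moreover have "real k \<le> norm (X l)" if "l \<in> S" for l
      using far[of "X l"] *(3)[OF that] \<eta>(2)[of k] R by simp
    moreover have "norm (- (2 *\<^sub>R (y - z))) \<le> 2 * \<eta> k" using *(2) by simp
    ultimately have "approx k y X \<mu> v (- (2 *\<^sub>R (y - z)))"
      unfolding approx_def by (intro conjI ballI * *(6)[unfolded proximal_subgradient_diff_const]) simp_all
    then show ?thesis by blast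
  qed
  then obtain y X \<mu> v q where "\<And>k. approx k (y k) (X k) (\<mu> k) (v k) (q k)"
    by metis
  then have y: "\<And>k. y k \<in> \<Omega>" "\<And>k. real k \<le> norm (y k)"
    and X: "\<And>k l. l \<in> S \<Longrightarrow> real k \<le> norm (X k l)"
    and \<mu>: "\<And>k l. l \<in> S \<Longrightarrow> 0 < \<mu> k l" "\<And>k. (\<Sum>l\<in>S. \<mu> k l) = 1"
    and v: "\<And>k l. l \<in> S \<Longrightarrow> proximal_subgradient (h l) (X k l) (v k l)" "\<And>k l. l \<in> S \<Longrightarrow> norm (v k l) \<le> L"
    and q: "\<And>k. norm (q k) \<le> 2 * \<eta> k"
           "\<And>k. q k - (\<Sum>l\<in>S. \<mu> k l *\<^sub>R v k l) \<in> frechet_normal_cone \<Omega> (y k)"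
    unfolding approx_def by simp_all
  have norm_at_top: "filterlim (\<lambda>k. norm (x (\<phi> k))) at_top sequentially"
    if "\<And>k. real k \<le> norm (x k)" "strict_mono \<phi>" for x :: "nat \<Rightarrow> 'a" and \<phi> :: "nat \<Rightarrow> nat"
  proof (rule filterlim_at_top_mono[OF filterlim_real_sequentially], rule always_eventually, rule allI)
    fix k show "real k \<le> norm (x (\<phi> k))"
      using that(1)[of "\<phi> k"] seq_suble[OF that(2), of k] by linarith
  qed

  \<comment> \<open>Multipliers and subgradients converge along one common subsequence, since they form a
    sequence in a compact set of functions of \<open>l\<close>; the value \<open>(0, 0)\<close> outside \<open>S\<close> keeps them
    in that set.\<close>
  define w where "w k l = (if l \<in> S then (\<mu> k l, v k l) else (0, 0))" for k l
  have "compact (Pi UNIV (\<lambda>_. {0..1} \<times> cball 0 L) :: ('l \<Rightarrow> real \<times> 'a) set)"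
    by (intro compact_Pi_UNIV compact_Times) auto
  then have "seq_compact (Pi UNIV (\<lambda>_. {0..1} \<times> cball 0 L) :: ('l \<Rightarrow> real \<times> 'a) set)"
    by (rule compact_imp_seq_compact)
  moreover have "w k \<in> Pi UNIV (\<lambda>_. {0..1} \<times> cball 0 L)" for k
  proof -
    have "\<mu> k l \<le> 1" if "l \<in> S" for l
      using member_le_sum[OF that _ S(1), of "\<mu> k"] \<mu> by (auto intro: less_imp_le)
    then show ?thesis using \<mu>(1) v(2) L by (auto simp: w_def less_imp_le)
  qed
  ultimately obtain W \<phi> where \<phi>: "strict_mono \<phi>" and W: "(w \<circ> \<phi>) \<longlonglongrightarrow> W"
    by (meson seq_compactE)
  have W_l: "(\<lambda>k. w (\<phi> k) l) \<longlonglongrightarrow> W l" for l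
    using continuous_on_tendsto_compose[OF continuous_on_product_coordinates[of l] W] by (simp add: o_def)
  have \<mu>_lim: "(\<lambda>k. \<mu> (\<phi> k) l) \<longlonglongrightarrow> fst (W l)" and v_lim: "(\<lambda>k. v (\<phi> k) l) \<longlonglongrightarrow> snd (W l)" if "l \<in> S" for l
    using tendsto_fst[OF W_l[of l]] tendsto_snd[OF W_l[of l]] that by (simp_all add: w_def)

  show thesis
  proof (rule that[of "\<lambda>l. fst (W l)" "\<lambda>l. snd (W l)"])
    show "0 \<le> fst (W l)" if "l \<in> S" for l
      using \<mu>_lim[OF that] by (rule LIMSEQ_le_const) (use \<mu>(1)[OF that] in \<open>auto intro: less_imp_le\<close>)
    have "(\<lambda>k. \<Sum>l\<in>S. \<mu> (\<phi> k) l) \<longlonglongrightarrow> (\<Sum>l\<in>S. fst (W l))"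
      using \<mu>_lim by (intro tendsto_sum)
    then show "(\<Sum>l\<in>S. fst (W l)) = 1"
      by (simp add: \<mu>(2) LIMSEQ_const_iff)
    show "snd (W l) \<in> subdifferential_at_infinity (h l)" if l: "l \<in> S" for l
      unfolding subdifferential_at_infinity_def
    proof (intro CollectI exI[of _ "\<lambda>k. X (\<phi> k) l"] exI[of _ "\<lambda>k. (v (\<phi> k) l, - 1)"] conjI allI)
      show "filterlim (\<lambda>k. norm (X (\<phi> k) l)) at_top sequentially"
        using norm_at_top[of "\<lambda>k. X k l", OF X[OF l] \<phi>] .
      show "(v (\<phi> k) l, - 1) \<in> limiting_normal_cone (epigraph UNIV (h l)) (X (\<phi> k) l, h l (X (\<phi> k) l))" for k
        using v(1)[OF l] by (rule proximal_subgradient_limiting_normal)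
      show "(\<lambda>k. (v (\<phi> k) l, - 1)) \<longlonglongrightarrow> (snd (W l), - 1)"
        using v_lim[OF l] by (intro tendsto_intros)
    qed
    have "(\<lambda>k. 2 * \<eta> k) \<longlonglongrightarrow> 0"
      using tendsto_mult_right_zero[OF \<open>\<eta> \<longlonglongrightarrow> 0\<close>, of 2] .
    then have "q \<longlonglongrightarrow> 0" by (rule Lim_null_comparison[rotated]) (simp add: q)
    then have "(\<lambda>k. q (\<phi> k)) \<longlonglongrightarrow> 0"
      using LIMSEQ_subseq_LIMSEQ[OF _ \<phi>, of q 0] by (simp add: o_def)
    then have "(\<lambda>k. q (\<phi> k) - (\<Sum>l\<in>S. \<mu> (\<phi> k) l *\<^sub>R v (\<phi> k) l)) \<longlonglongrightarrow> 0 - (\<Sum>l\<in>S. fst (W l) *\<^sub>R snd (W l))"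
      using \<mu>_lim v_lim by (intro tendsto_intros)
    then show "- (\<Sum>l\<in>S. fst (W l) *\<^sub>R snd (W l)) \<in> normal_cone_at_infinity \<Omega>"
      unfolding normal_cone_at_infinity_def
      by (intro CollectI exI[of _ "\<lambda>k. y (\<phi> k)"] exI[of _ "\<lambda>k. q (\<phi> k) - (\<Sum>l\<in>S. \<mu> (\<phi> k) l *\<^sub>R v (\<phi> k) l)"] conjI allI)
        (simp_all add: y q norm_at_top[OF y(2) \<phi>])
  qed
qed

section \<open>Existence and compactness of solutions\<close>

lemma closed_sublevel_lower_semicontinuous:
  fixes f :: "'a::topological_space \<Rightarrow> real"
  assumes "lower_semicontinuous f"
  shows "closed {x. f x \<le> c}"
proof -
  have "open {x. c < f x}"
  proof (rule open_subopen[THEN iffD2], rule ballI)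
    fix x assume "x \<in> {x. c < f x}"
    then have x: "c < f x" by simp
    have "ereal (f x) \<le> Liminf (at x) (\<lambda>y. ereal (f y))"
      using assms unfolding lower_semicontinuous_def by blast
    then have "\<forall>b<ereal (f x). \<forall>\<^sub>F y in at x. b < ereal (f y)"
      by (simp only: le_Liminf_iff)
    from this[rule_format, of "ereal c"] x have "\<forall>\<^sub>F y in at x. c < f y" by simp
    then obtain T where T: "open T" "x \<in> T" "\<And>y. y \<in> T \<Longrightarrow> y \<noteq> x \<Longrightarrow> c < f y"
      unfolding eventually_at_topological by blast
    have "T \<subseteq> {x. c < f x}"
    proof
      fix y assume "y \<in> T"
      then show "y \<in> {x. c < f x}" using T(3)[of y] x by (cases "y = x") simp_all
    qed
    with T(1,2) show "\<exists>T. open T \<and> x \<in> T \<and> T \<subseteq> {x. c < f x}"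
      by (intro exI[of _ T] conjI)
  qed
  moreover have "{x. f x \<le> c} = - {x. c < f x}" by auto
  ultimately show ?thesis by (simp only: closed_def double_compl)
qed

text \<open>The solution set is the intersection of a decreasing sequence of nonempty compact sublevel
sets whose levels tend to the infimum.\<close>

lemma global_solutions_compact_if_sublevel_bounded:
  fixes \<phi> :: "'a::heine_borel \<Rightarrow> real"
  assumes cl: "\<And>c. closed {x \<in> F. \<phi> x \<le> c}" and "F \<noteq> {}" and bdd: "bdd_below (\<phi> ` F)"
    and "e > 0" and bounded: "bounded {x \<in> F. \<phi> x < (INF x\<in>F. \<phi> x) + e}"
  shows "global_solutions F \<phi> \<noteq> {} \<and> compact (global_solutions F \<phi>)"
proof -
  define m where "m = (INF x\<in>F. \<phi> x)"
  have m_le: "m \<le> \<phi> x" if "x \<in> F" for x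
    unfolding m_def using bdd that by (rule cINF_lower)
  define A where "A n = {x \<in> F. \<phi> x \<le> m + e / real (n + 2)}" for n :: nat
  have "e / real (n + 2) < e" for n
    using \<open>e > 0\<close> by (simp add: field_simps add_pos_nonneg)
  then have compact: "compact {x \<in> F. \<phi> x \<le> c}" if "c \<le> m + e / real (n + 2)" for c n
    unfolding compact_eq_bounded_closed using cl that
    by (auto intro!: bounded_subset[OF bounded] simp: m_def[symmetric]) (smt (verit))
  have "\<Inter>(range A) \<noteq> {}"
  proof (rule compact_nest)
    show "compact (A n)" for n unfolding A_def by (rule compact[of _ n]) simp
    show "A n \<noteq> {}" for n
    proof -
      have "m < m + e / real (n + 2)" using \<open>e > 0\<close> by simp
      then obtain x where "x \<in> F" "\<phi> x < m + e / real (n + 2)"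
        unfolding m_def using cINF_less_iff[OF \<open>F \<noteq> {}\<close> bdd] by blast
      then show ?thesis by (auto simp: A_def intro: less_imp_le)
    qed
    show "A n \<subseteq> A k" if "k \<le> n" for k n
    proof -
      have "e / real (n + 2) \<le> e / real (k + 2)"
        using that \<open>e > 0\<close> by (intro divide_left_mono) auto
      then show ?thesis by (auto simp: A_def)
    qed
  qed
  then obtain x where x: "x \<in> F" "\<And>n. \<phi> x \<le> m + e / real (n + 2)"
    by (auto simp: A_def)
  have "(\<lambda>n. m + e / real (n + 2)) \<longlonglongrightarrow> m + 0"
    by (intro tendsto_intros LIMSEQ_ignore_initial_segment[OF lim_const_over_n])
  then have "\<phi> x \<le> m + 0"
    by (rule LIMSEQ_le_const) (use x(2) in blast)
  then have "x \<in> {x \<in> F. \<phi> x \<le> m}" using x(1) by simp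
  moreover have "global_solutions F \<phi> = {x \<in> F. \<phi> x \<le> m}"
    using m_le unfolding global_solutions_def m_def[symmetric] by (auto intro: antisym)
  moreover have "compact {x \<in> F. \<phi> x \<le> m}"
    using \<open>e > 0\<close> by (intro compact[of m 0]) simp
  ultimately show ?thesis by auto
qed

theorem theorem3p2:
  fixes \<Omega> :: "(real ^ 'n) set"
    and m p :: nat
    and f g :: "nat \<Rightarrow> real ^ 'n \<Rightarrow> real"
  assumes "\<Omega> \<noteq> {}" and "closed \<Omega>"
    and "m \<ge> 1"
    and "\<forall>i\<in>{1..m}. lower_semicontinuous (f i) \<and> lipschitz_at_infinity (f i)"
    and "\<forall>j\<in>{1..p}. lower_semicontinuous (g j) \<and> lipschitz_at_infinity (g j)"
    and "feasible_set \<Omega> {1..p} g \<noteq> {}"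
    and "\<not> bounded (feasible_set \<Omega> {1..p} g)"
    and "bdd_below (max_function {1..m} f ` feasible_set \<Omega> {1..p} g)"
    and "CQ_at_infinity \<Omega> {1..p} g"
    and "0 \<notin> convex hull (\<Union>i\<in>{1..m}. subdifferential_at_infinity (f i))
             + pos_combinations {1..p} (\<lambda>j. subdifferential_at_infinity (g j))
             + normal_cone_at_infinity \<Omega>"
  shows "global_solutions (feasible_set \<Omega> {1..p} g) (max_function {1..m} f) \<noteq> {}
       \<and> compact (global_solutions (feasible_set \<Omega> {1..p} g) (max_function {1..m} f))"
proof (rule ccontr)
  assume contra: "\<not> ?thesis"
  let ?I = "{1..m}" and ?J = "{1..p}"
  let ?F = "feasible_set \<Omega> ?J g" and ?\<phi> = "max_function ?I f"
  define c where "c = (INF x\<in>?F. ?\<phi> x)"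
  have I: "finite ?I" "?I \<noteq> {}" using \<open>m \<ge> 1\<close> by auto
  have max_le: "?\<phi> x \<le> a \<longleftrightarrow> (\<forall>i\<in>?I. f i x \<le> a)" and max_less: "?\<phi> x < a \<longleftrightarrow> (\<forall>i\<in>?I. f i x < a)"
    and max_ge: "a \<le> ?\<phi> x \<longleftrightarrow> (\<exists>i\<in>?I. a \<le> f i x)" for x a
    unfolding max_function_def using I by (auto simp: Max_ge_iff)
  have closed_sublevel: "closed {x \<in> ?F. ?\<phi> x \<le> a}" for a
  proof -
    have "{x \<in> ?F. ?\<phi> x \<le> a} = \<Omega> \<inter> (\<Inter>j\<in>?J. {x. g j x \<le> 0}) \<inter> (\<Inter>i\<in>?I. {x. f i x \<le> a})"
      unfolding feasible_set_def max_le by auto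
    also have "closed \<dots>"
      using assms(2,4,5) by (intro closed_Int closed_INT ballI closed_sublevel_lower_semicontinuous) auto
    finally show ?thesis .
  qed
  have unbounded: "\<not> bounded {x \<in> ?F. ?\<phi> x < c + e}" if "e > 0" for e
    using global_solutions_compact_if_sublevel_bounded[OF closed_sublevel assms(6,8) that] contra
    unfolding c_def by blast

  \<comment> \<open>A feasible point has some \<open>f i\<close> at least \<open>c\<close> and an infeasible point of \<open>\<Omega>\<close> has some
    \<open>g j\<close> above \<open>0\<close>, so on \<open>\<Omega>\<close> the maximum of all \<open>f i - c\<close> and \<open>g j\<close> is nonnegative; along a
    minimizing sequence in the feasible set it is asymptotically at most \<open>0\<close>.\<close>
  let ?S = "?I <+> ?J"
  define h where "h = case_sum f g"
  define b where "b = case_sum (\<lambda>_::nat. c) (\<lambda>_::nat. 0)"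
  have S: "finite ?S" "?S \<noteq> {}" using I by auto
  have lip: "lipschitz_at_infinity (h l)" if "l \<in> ?S" for l
    using that assms(4,5) by (auto simp: h_def)
  have level: "\<exists>l\<in>?S. b l \<le> h l x" if "x \<in> \<Omega>" for x
  proof (cases "x \<in> ?F")
    case True
    then have "c \<le> ?\<phi> x" unfolding c_def by (rule cINF_lower[OF assms(8)])
    then obtain i where "i \<in> ?I" "c \<le> f i x" using max_ge by blast
    then show ?thesis by (intro bexI[of _ "Inl i"]) (auto simp: h_def b_def)
  next
    case False
    with that obtain j where "j \<in> ?J" "0 < g j x"
      by (auto simp: feasible_set_def not_le)
    then show ?thesis by (intro bexI[of _ "Inr j"]) (auto simp: h_def b_def)
  qed
  have escape: "\<exists>x\<in>\<Omega>. \<rho> < norm x \<and> (\<forall>l\<in>?S. h l x < b l + e)" if e: "0 < e" for e \<rho>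
  proof -
    obtain x where x: "x \<in> ?F" "?\<phi> x < c + e" "\<rho> < norm x"
      using unbounded[OF e] unfolding bounded_iff by (auto simp: not_le)
    show ?thesis
      using e x(1,3) x(2)[unfolded max_less]
      by (intro bexI[of _ x]) (auto simp: feasible_set_def h_def b_def intro: le_less_trans)
  qed
  obtain \<mu> v where \<mu>_nonneg: "\<And>l. l \<in> ?S \<Longrightarrow> 0 \<le> \<mu> l" and \<mu>_sum: "(\<Sum>l\<in>?S. \<mu> l) = 1"
    and v: "\<And>l. l \<in> ?S \<Longrightarrow> v l \<in> subdifferential_at_infinity (h l)"
    and normal: "- (\<Sum>l\<in>?S. \<mu> l *\<^sub>R v l) \<in> normal_cone_at_infinity \<Omega>"
    by (rule multiplier_rule_at_infinity[OF assms(2) S lip level escape]) (assumption | rule that)+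
  define \<alpha> where "\<alpha> i = \<mu> (Inl i)" for i
  define \<beta> where "\<beta> j = \<mu> (Inr j)" for j
  define s t where "s = (\<Sum>i\<in>?I. \<alpha> i *\<^sub>R v (Inl i))" and "t = (\<Sum>j\<in>?J. \<beta> j *\<^sub>R v (Inr j))"
  have \<alpha>: "0 \<le> \<alpha> i" "v (Inl i) \<in> subdifferential_at_infinity (f i)" if "i \<in> ?I" for i
    using \<mu>_nonneg[OF InlI[OF that]] v[OF InlI[OF that]] by (simp_all add: \<alpha>_def h_def)
  have \<beta>: "0 \<le> \<beta> j" "v (Inr j) \<in> subdifferential_at_infinity (g j)" if "j \<in> ?J" for j
    using \<mu>_nonneg[OF InrI[OF that]] v[OF InrI[OF that]] by (simp_all add: \<beta>_def h_def)
  have total: "sum \<alpha> ?I + sum \<beta> ?J = 1"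
    using \<mu>_sum by (simp add: sum.Plus \<alpha>_def \<beta>_def)
  have st: "- (s + t) \<in> normal_cone_at_infinity \<Omega>"
    using normal by (simp add: sum.Plus \<alpha>_def \<beta>_def s_def t_def)
  \<comment> \<open>Without weight on the objectives the relation contradicts the constraint qualification;
    otherwise, divided by that weight, it contradicts the last hypothesis.\<close>
  show False
  proof (cases "sum \<alpha> ?I = 0")
    case True
    then have "\<forall>i\<in>?I. \<alpha> i = 0" using \<alpha>(1) sum_nonneg_eq_0_iff[of ?I \<alpha>] by simp
    then have "s = 0" by (simp add: s_def)
    have "t \<in> (\<Sum>j\<in>?J. (\<lambda>v. \<beta> j *\<^sub>R v) ` subdifferential_at_infinity (g j))"
      unfolding t_def set_sum_alt[OF finite_atLeastAtMost] using \<beta>(2) by blast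
    then have "t + - t \<in> (\<Sum>j\<in>?J. (\<lambda>v. \<beta> j *\<^sub>R v) ` subdifferential_at_infinity (g j))
        + normal_cone_at_infinity \<Omega>"
      using st \<open>s = 0\<close> by (intro set_plus_intro) simp_all
    moreover have "sum \<beta> ?J > 0" using total True by simp
    ultimately show False
      using assms(9) \<beta>(1) unfolding CQ_at_infinity_def by auto
  next
    case False
    define a where "a = sum \<alpha> ?I"
    have "a > 0" using False \<alpha>(1) by (auto simp: a_def less_le intro: sum_nonneg)
    have "(\<Sum>i\<in>?I. (\<alpha> i / a) *\<^sub>R v (Inl i)) \<in> convex hull (\<Union>i\<in>?I. subdifferential_at_infinity (f i))"
    proof (rule convex_sum)
      show "(\<Sum>i\<in>?I. \<alpha> i / a) = 1"
        using \<open>a > 0\<close> by (simp add: a_def flip: sum_divide_distrib)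
      show "0 \<le> \<alpha> i / a" if "i \<in> ?I" for i
        using \<alpha>(1)[OF that] \<open>a > 0\<close> by simp
      show "v (Inl i) \<in> convex hull (\<Union>i\<in>?I. subdifferential_at_infinity (f i))" if "i \<in> ?I" for i
        using \<alpha>(2)[OF that] that by (intro hull_inc) blast
    qed auto
    moreover have "(\<Sum>i\<in>?I. (\<alpha> i / a) *\<^sub>R v (Inl i)) = (1 / a) *\<^sub>R s"
      by (simp add: s_def scaleR_sum_right divide_inverse_commute)
    moreover have "(1 / a) *\<^sub>R t = (\<Sum>j\<in>?J. (\<beta> j / a) *\<^sub>R v (Inr j))"
      by (simp add: t_def scaleR_sum_right divide_inverse_commute)
    then have "(1 / a) *\<^sub>R t \<in> pos_combinations ?J (\<lambda>j. subdifferential_at_infinity (g j))"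
      unfolding pos_combinations_def using \<beta> \<open>a > 0\<close>
      by (intro CollectI exI[of _ "\<lambda>j. \<beta> j / a"] exI[of _ "\<lambda>j. v (Inr j)"]) auto
    moreover have "(1 / a) *\<^sub>R (- (s + t)) \<in> normal_cone_at_infinity \<Omega>"
      using st \<open>a > 0\<close> by (intro normal_cone_at_infinity_scaleR) simp_all
    ultimately have "(1 / a) *\<^sub>R s + (1 / a) *\<^sub>R t + (1 / a) *\<^sub>R (- (s + t))
        \<in> convex hull (\<Union>i\<in>?I. subdifferential_at_infinity (f i))
          + pos_combinations ?J (\<lambda>j. subdifferential_at_infinity (g j))
          + normal_cone_at_infinity \<Omega>"
      by (intro set_plus_intro) simp_all
    moreover have "(1 / a) *\<^sub>R s + (1 / a) *\<^sub>R t + (1 / a) *\<^sub>R (- (s + t)) = 0"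
      by (simp flip: scaleR_add_right)
    ultimately show False using assms(10) by simp
  qed
qed

end
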